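(* Markov's principle $\neg\neg P(x)\to P(x)$ is independent of the other axioms of constructive Euclidean field theory; that is, it is not provable from them with intuitionistic logic.
   Context: Constructive Euclidean field theory is the theory, with intuitionistic first-order logic, in the language of commutative rings ($0,1,+,\cdot,-$) with a unary predicate $P(x)$ ("$x$ is positive"), whose axioms are the commutative ring axioms together with: stability of equality: $\neg x\neq y\to x=y$; EF0: $0\neq 1$; EF1: $x\neq 0\to\exists y\,(x\cdot y=1)$; EF2: $P(x)\wedge P(y)\to P(x+y)\wedge P(x\cdot y)$; EF3: $x+y=0\to\neg(P(x)\wedge P(y))$; EF4: $x+y=0\wedge\neg P(x)\wedge\neg P(y)\to x=0$; EF5: $x+y=0\wedge\neg P(y)\to\exists z\,(z\cdot z=x)$; EF6 (Markov's principle): $\neg\neg P(x)\to P(x)$. *)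

theory Defs
  imports Main
begin

text \<open>
  First-order syntax over the language of commutative rings with a unary predicate
  symbol. Variables are de Bruijn indices: index \<open>n\<close> refers to the \<open>n\<close>-th enclosing
  quantifier, counted from the inside starting at 0.
\<close>

datatype tm =
    Var nat
  | Zero  ("\<^bold>0")
  | One  ("\<^bold>1")
  | Add tm tm  (infixl "\<^bold>+" 65)
  | Mul tm tm  (infixl "\<^bold>*" 70)
  | Minus tm  ("\<^bold>-")

datatype fm =
    Falsum  ("\<^bold>\<bottom>")
  | Eq tm tm  (infix "\<^bold>=" 60)
  | Pos tm
  | Conj fm fm  (infixr "\<^bold>\<and>" 55)
  | Disj fm fm  (infixr "\<^bold>\<or>" 54)
  | Imp fm fm  (infixr "\<^bold>\<longrightarrow>" 53)
  | Forall fm  ("\<^bold>\<forall>_" [56] 56)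
  | Exists fm  ("\<^bold>\<exists>_" [56] 56)

abbreviation Neg :: "fm \<Rightarrow> fm"  ("\<^bold>\<not>_" [58] 58) where
  "\<^bold>\<not>A \<equiv> A \<^bold>\<longrightarrow> \<^bold>\<bottom>"

abbreviation Neq :: "tm \<Rightarrow> tm \<Rightarrow> fm"  (infix "\<^bold>\<noteq>" 60) where
  "s \<^bold>\<noteq> t \<equiv> \<^bold>\<not> (s \<^bold>= t)"

text \<open>Simultaneous capture-avoiding substitution.\<close>

primrec subst_tm :: "(nat \<Rightarrow> tm) \<Rightarrow> tm \<Rightarrow> tm" where
  "subst_tm \<sigma> (Var n) = \<sigma> n"
| "subst_tm \<sigma> \<^bold>0 = \<^bold>0"
| "subst_tm \<sigma> \<^bold>1 = \<^bold>1"
| "subst_tm \<sigma> (s \<^bold>+ t) = subst_tm \<sigma> s \<^bold>+ subst_tm \<sigma> t"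
| "subst_tm \<sigma> (s \<^bold>* t) = subst_tm \<sigma> s \<^bold>* subst_tm \<sigma> t"
| "subst_tm \<sigma> (\<^bold>- t) = \<^bold>- (subst_tm \<sigma> t)"

definition under_binder :: "(nat \<Rightarrow> tm) \<Rightarrow> nat \<Rightarrow> tm" where
  "under_binder \<sigma> = case_nat (Var 0) (\<lambda>n. subst_tm (\<lambda>i. Var (Suc i)) (\<sigma> n))"

primrec subst_fm :: "(nat \<Rightarrow> tm) \<Rightarrow> fm \<Rightarrow> fm" where
  "subst_fm \<sigma> \<^bold>\<bottom> = \<^bold>\<bottom>"
| "subst_fm \<sigma> (s \<^bold>= t) = (subst_tm \<sigma> s \<^bold>= subst_tm \<sigma> t)"
| "subst_fm \<sigma> (Pos t) = Pos (subst_tm \<sigma> t)"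
| "subst_fm \<sigma> (A \<^bold>\<and> B) = (subst_fm \<sigma> A \<^bold>\<and> subst_fm \<sigma> B)"
| "subst_fm \<sigma> (A \<^bold>\<or> B) = (subst_fm \<sigma> A \<^bold>\<or> subst_fm \<sigma> B)"
| "subst_fm \<sigma> (A \<^bold>\<longrightarrow> B) = (subst_fm \<sigma> A \<^bold>\<longrightarrow> subst_fm \<sigma> B)"
| "subst_fm \<sigma> (\<^bold>\<forall> A) = \<^bold>\<forall> (subst_fm (under_binder \<sigma>) A)"
| "subst_fm \<sigma> (\<^bold>\<exists> A) = \<^bold>\<exists> (subst_fm (under_binder \<sigma>) A)"

text \<open>
  \<open>lift A\<close> shifts every free variable of \<open>A\<close> by one, so that index 0 becomes fresh;
  \<open>inst t A\<close> replaces index 0 by \<open>t\<close> and shifts the other free variables down.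
\<close>

definition lift :: "fm \<Rightarrow> fm" where
  "lift A = subst_fm (\<lambda>n. Var (Suc n)) A"

definition inst :: "tm \<Rightarrow> fm \<Rightarrow> fm" where
  "inst t A = subst_fm (case_nat t Var) A"

text \<open>
  Natural deduction for intuitionistic first-order logic with equality. The eigenvariable
  conditions of \<open>AllI\<close> and \<open>ExE\<close> are expressed by lifting the side formulas.
\<close>

inductive deriv :: "fm set \<Rightarrow> fm \<Rightarrow> bool"  (infix "\<turnstile>" 50) where
  Assm: "A \<in> \<Gamma> \<Longrightarrow> \<Gamma> \<turnstile> A"
| FalsumE: "\<Gamma> \<turnstile> \<^bold>\<bottom> \<Longrightarrow> \<Gamma> \<turnstile> A"
| ConjI: "\<Gamma> \<turnstile> A \<Longrightarrow> \<Gamma> \<turnstile> B \<Longrightarrow> \<Gamma> \<turnstile> A \<^bold>\<and> B"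
| ConjE1: "\<Gamma> \<turnstile> A \<^bold>\<and> B \<Longrightarrow> \<Gamma> \<turnstile> A"
| ConjE2: "\<Gamma> \<turnstile> A \<^bold>\<and> B \<Longrightarrow> \<Gamma> \<turnstile> B"
| DisjI1: "\<Gamma> \<turnstile> A \<Longrightarrow> \<Gamma> \<turnstile> A \<^bold>\<or> B"
| DisjI2: "\<Gamma> \<turnstile> B \<Longrightarrow> \<Gamma> \<turnstile> A \<^bold>\<or> B"
| DisjE: "\<Gamma> \<turnstile> A \<^bold>\<or> B \<Longrightarrow> insert A \<Gamma> \<turnstile> C \<Longrightarrow> insert B \<Gamma> \<turnstile> C \<Longrightarrow> \<Gamma> \<turnstile> C"
| ImpI: "insert A \<Gamma> \<turnstile> B \<Longrightarrow> \<Gamma> \<turnstile> A \<^bold>\<longrightarrow> B"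
| ImpE: "\<Gamma> \<turnstile> A \<^bold>\<longrightarrow> B \<Longrightarrow> \<Gamma> \<turnstile> A \<Longrightarrow> \<Gamma> \<turnstile> B"
| AllI: "lift ` \<Gamma> \<turnstile> A \<Longrightarrow> \<Gamma> \<turnstile> \<^bold>\<forall> A"
| AllE: "\<Gamma> \<turnstile> \<^bold>\<forall> A \<Longrightarrow> \<Gamma> \<turnstile> inst t A"
| ExI: "\<Gamma> \<turnstile> inst t A \<Longrightarrow> \<Gamma> \<turnstile> \<^bold>\<exists> A"
| ExE: "\<Gamma> \<turnstile> \<^bold>\<exists> A \<Longrightarrow> insert A (lift ` \<Gamma>) \<turnstile> lift B \<Longrightarrow> \<Gamma> \<turnstile> B"
| EqRefl: "\<Gamma> \<turnstile> t \<^bold>= t"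
| EqSubst: "\<Gamma> \<turnstile> s \<^bold>= t \<Longrightarrow> \<Gamma> \<turnstile> inst s A \<Longrightarrow> \<Gamma> \<turnstile> inst t A"

text \<open>
  The axioms are universally closed. Under two universal quantifiers \<open>x\<close> is \<open>Var 1\<close> and
  \<open>y\<close> is \<open>Var 0\<close>, and a further existential \<open>z\<close> shifts these to \<open>Var 2\<close> and \<open>Var 1\<close>.
\<close>

definition comm_ring_axioms :: "fm set" where
  "comm_ring_axioms =
    {\<^bold>\<forall>\<^bold>\<forall>\<^bold>\<forall> (Var 2 \<^bold>+ Var 1 \<^bold>+ Var 0 \<^bold>= Var 2 \<^bold>+ (Var 1 \<^bold>+ Var 0)),
     \<^bold>\<forall>\<^bold>\<forall> (Var 1 \<^bold>+ Var 0 \<^bold>= Var 0 \<^bold>+ Var 1),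
     \<^bold>\<forall> (Var 0 \<^bold>+ \<^bold>0 \<^bold>= Var 0),
     \<^bold>\<forall> (Var 0 \<^bold>+ \<^bold>- (Var 0) \<^bold>= \<^bold>0),
     \<^bold>\<forall>\<^bold>\<forall>\<^bold>\<forall> (Var 2 \<^bold>* Var 1 \<^bold>* Var 0 \<^bold>= Var 2 \<^bold>* (Var 1 \<^bold>* Var 0)),
     \<^bold>\<forall>\<^bold>\<forall> (Var 1 \<^bold>* Var 0 \<^bold>= Var 0 \<^bold>* Var 1),
     \<^bold>\<forall> (Var 0 \<^bold>* \<^bold>1 \<^bold>= Var 0),
     \<^bold>\<forall>\<^bold>\<forall>\<^bold>\<forall> (Var 2 \<^bold>* (Var 1 \<^bold>+ Var 0) \<^bold>= Var 2 \<^bold>* Var 1 \<^bold>+ Var 2 \<^bold>* Var 0)}"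

definition eq_stability :: fm where
  "eq_stability = \<^bold>\<forall>\<^bold>\<forall> (\<^bold>\<not> (Var 1 \<^bold>\<noteq> Var 0) \<^bold>\<longrightarrow> Var 1 \<^bold>= Var 0)"

definition EF0 :: fm where
  "EF0 = (\<^bold>0 \<^bold>\<noteq> \<^bold>1)"

definition EF1 :: fm where
  "EF1 = \<^bold>\<forall> (Var 0 \<^bold>\<noteq> \<^bold>0 \<^bold>\<longrightarrow> \<^bold>\<exists> (Var 1 \<^bold>* Var 0 \<^bold>= \<^bold>1))"

definition EF2 :: fm where
  "EF2 = \<^bold>\<forall>\<^bold>\<forall> (Pos (Var 1) \<^bold>\<and> Pos (Var 0)
            \<^bold>\<longrightarrow> Pos (Var 1 \<^bold>+ Var 0) \<^bold>\<and> Pos (Var 1 \<^bold>* Var 0))"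

definition EF3 :: fm where
  "EF3 = \<^bold>\<forall>\<^bold>\<forall> (Var 1 \<^bold>+ Var 0 \<^bold>= \<^bold>0 \<^bold>\<longrightarrow> \<^bold>\<not> (Pos (Var 1) \<^bold>\<and> Pos (Var 0)))"

definition EF4 :: fm where
  "EF4 = \<^bold>\<forall>\<^bold>\<forall> (Var 1 \<^bold>+ Var 0 \<^bold>= \<^bold>0 \<^bold>\<and> \<^bold>\<not> Pos (Var 1) \<^bold>\<and> \<^bold>\<not> Pos (Var 0) \<^bold>\<longrightarrow> Var 1 \<^bold>= \<^bold>0)"

definition EF5 :: fm where
  "EF5 = \<^bold>\<forall>\<^bold>\<forall> (Var 1 \<^bold>+ Var 0 \<^bold>= \<^bold>0 \<^bold>\<and> \<^bold>\<not> Pos (Var 0) \<^bold>\<longrightarrow> \<^bold>\<exists> (Var 0 \<^bold>* Var 0 \<^bold>= Var 2))"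

definition EF6 :: fm where
  "EF6 = \<^bold>\<forall> (\<^bold>\<not>\<^bold>\<not> Pos (Var 0) \<^bold>\<longrightarrow> Pos (Var 0))"

definition euclidean_field_axioms :: "fm set" where
  "euclidean_field_axioms =
    comm_ring_axioms \<union> {eq_stability, EF0, EF1, EF2, EF3, EF4, EF5, EF6}"

end

theory Submission
  imports Defs Complex_Main
begin

text \<open>
  The unprovability is witnessed by a Kripke model with two worlds, \<^term>\<open>False\<close> below
  \<^term>\<open>True\<close>, both of which carry the field of real numbers with its true equality; the
  worlds differ only in the extension of positivity. At the upper world \<open>P\<close> means \<open>x > 0\<close>,
  at the root it means \<open>x \<ge> 1\<close>.

  At the upper world the model is the classical Euclidean field of the reals. At the root,
  \<open>\<not>P(x)\<close> is forced exactly when \<open>x \<le> 0\<close>, since the negation quantifies over the upper world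
  as well (\<open>forces_not_pos\<close>). In EF4 and EF5 positivity occurs only in this negated form, so
  these axioms cannot tell which of the positive reals are already positive at the root; EF3
  holds as soon as no two positive elements are opposite. EF2 asks that the elements positive
  at the root be closed under addition and multiplication, and the reals \<open>x \<ge> 1\<close> are. Markov's
  principle fails: \<open>1/2\<close> becomes positive at the upper world, so \<open>\<not>\<not>P(1/2)\<close> is forced at the
  root, while \<open>P(1/2)\<close> is not.

  It remains that derivable formulas are forced, lemma \<open>soundness\<close>. As the domain does not
  vary from world to world and equality is interpreted by identity, this is an induction on
  derivations that rests on monotonicity of forcing (\<open>forces_mono\<close>) and the
  substitution lemma (\<open>forces_subst\<close>).
\<close>

section \<open>Kripke models with constant domain\<close>

primrec eval :: "(nat \<Rightarrow> 'a::{zero,one,plus,times,uminus}) \<Rightarrow> tm \<Rightarrow> 'a" where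
  "eval e (Var n) = e n"
| "eval e \<^bold>0 = 0"
| "eval e \<^bold>1 = 1"
| "eval e (s \<^bold>+ t) = eval e s + eval e t"
| "eval e (s \<^bold>* t) = eval e s * eval e t"
| "eval e (\<^bold>- t) = - eval e t"

text \<open>
  Only implication looks at later worlds. The usual clause for \<open>\<forall>\<close> does so as well, but in a
  constant domain monotonicity of forcing makes that redundant.
\<close>

primrec forces :: "('w::preorder \<Rightarrow> 'a::{zero,one,plus,times,uminus} \<Rightarrow> bool)
    \<Rightarrow> 'w \<Rightarrow> (nat \<Rightarrow> 'a) \<Rightarrow> fm \<Rightarrow> bool" where
  "forces P w e \<^bold>\<bottom> \<longleftrightarrow> False"
| "forces P w e (s \<^bold>= t) \<longleftrightarrow> eval e s = eval e t"
| "forces P w e (Pos t) \<longleftrightarrow> P w (eval e t)"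
| "forces P w e (A \<^bold>\<and> B) \<longleftrightarrow> forces P w e A \<and> forces P w e B"
| "forces P w e (A \<^bold>\<or> B) \<longleftrightarrow> forces P w e A \<or> forces P w e B"
| "forces P w e (A \<^bold>\<longrightarrow> B) \<longleftrightarrow> (\<forall>v\<ge>w. forces P v e A \<longrightarrow> forces P v e B)"
| "forces P w e (\<^bold>\<forall> A) \<longleftrightarrow> (\<forall>d. forces P w (case_nat d e) A)"
| "forces P w e (\<^bold>\<exists> A) \<longleftrightarrow> (\<exists>d. forces P w (case_nat d e) A)"

lemma forces_AllI: "(\<And>d. forces P w (case_nat d e) A) \<Longrightarrow> forces P w e (\<^bold>\<forall> A)"
  by simp

lemma forces_ImpI: "(\<And>v. w \<le> v \<Longrightarrow> forces P v e A \<Longrightarrow> forces P v e B) \<Longrightarrow> forces P w e (A \<^bold>\<longrightarrow> B)"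
  by simp

lemma forces_mono:
  assumes "mono P" and "w \<le> v" and "forces P w e A"
  shows "forces P v e A"
  using assms(2,3)
proof (induction A arbitrary: e)
  case (Pos t)
  then show ?case using monoD[OF assms(1), of w v] by (auto simp: le_fun_def)
next
  case (Imp A B)
  then show ?case using order_trans[OF assms(2)] by simp
next
  case (Disj A B)
  then show ?case by auto
next
  case (Forall A)
  then show ?case by simp
next
  case (Exists A)
  then show ?case unfolding forces.simps by blast
qed simp_all

section \<open>Soundness of intuitionistic logic\<close>

lemma eval_subst: "eval e (subst_tm \<sigma> t) = eval (\<lambda>n. eval e (\<sigma> n)) t"
  by (induction t) auto

lemma eval_under_binder:
  "(\<lambda>n. eval (case_nat d e) (under_binder \<sigma> n)) = case_nat d (\<lambda>n. eval e (\<sigma> n))"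
  by (rule ext) (auto simp: under_binder_def eval_subst split: nat.split)

text \<open>
  Substituting into a formula amounts to changing the environment; this is what makes the
  quantifier and equality rules sound.
\<close>

lemma forces_subst: "forces P w e (subst_fm \<sigma> A) = forces P w (\<lambda>n. eval e (\<sigma> n)) A"
  by (induction A arbitrary: \<sigma> e w) (auto simp: eval_subst eval_under_binder)

lemma forces_lift: "forces P w (case_nat d e) (lift A) = forces P w e A"
  by (simp add: lift_def forces_subst)

lemma forces_inst: "forces P w e (inst t A) = forces P w (case_nat (eval e t) e) A"
proof -
  have "(\<lambda>n. eval e (case_nat t Var n)) = case_nat (eval e t) e"
    by (rule ext) (auto split: nat.split)
  then show ?thesis by (simp add: inst_def forces_subst)
qed

text \<open>
  The world has to vary in the induction, because the rule for introducing an implication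
  passes to a later world; there the premises remain forced by monotonicity.
\<close>

lemma soundness:
  assumes "\<Gamma> \<turnstile> A" and "mono P" and "\<And>B. B \<in> \<Gamma> \<Longrightarrow> forces P w e B"
  shows "forces P w e A"
  using assms(1,3)
proof (induction arbitrary: w e rule: deriv.induct)
  case (DisjE \<Gamma> A B C)
  from DisjE.IH(1)[OF DisjE.prems] show ?case
    using DisjE.IH(2,3)[of w e] DisjE.prems by auto
next
  case (ImpI A \<Gamma> B)
  show ?case
  proof (rule forces_ImpI)
    fix v assume "w \<le> v" "forces P v e A"
    then show "forces P v e B"
      using ImpI.prems by (intro ImpI.IH) (auto intro: forces_mono[OF assms(2)])
  qed
next
  case (ImpE \<Gamma> A B)
  then show ?case by (metis forces.simps(6) order_refl)
next
  case (AllI \<Gamma> A)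
  have "forces P w (case_nat d e) A" for d
    using AllI.prems by (intro AllI.IH) (auto simp: forces_lift)
  then show ?case by simp
next
  case (AllE \<Gamma> A t)
  then show ?case by (simp add: forces_inst)
next
  case (ExI \<Gamma> t A)
  then show ?case by (auto simp: forces_inst)
next
  case (ExE \<Gamma> A B)
  then obtain d where d: "forces P w (case_nat d e) A" by fastforce
  have "forces P w (case_nat d e) (lift B)"
    using d ExE.prems by (intro ExE.IH(2)) (auto simp: forces_lift)
  then show ?case by (simp add: forces_lift)
next
  case (EqSubst \<Gamma> s t A)
  have "eval e s = eval e t" and "forces P w (case_nat (eval e s) e) A"
    using EqSubst.IH[OF EqSubst.prems] by (simp_all add: forces_inst)
  then show ?case by (simp add: forces_inst)
qed auto

section \<open>A two-world model over the reals\<close>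

definition delayed_pos :: "bool \<Rightarrow> real \<Rightarrow> bool" where
  "delayed_pos w x \<longleftrightarrow> (if w then 0 < x else 1 \<le> x)"

lemma mono_delayed_pos: "mono delayed_pos"
  by (auto simp: mono_def le_fun_def delayed_pos_def)

lemma all_later_bool: "(\<forall>v\<ge>w. Q v) \<longleftrightarrow> (w \<or> Q False) \<and> Q True" for w :: bool
  by (metis (full_types) le_bool_def)

lemma delayed_pos_add_mult:
  assumes "delayed_pos w x" and "delayed_pos w y"
  shows "delayed_pos w (x + y)" and "delayed_pos w (x * y)"
  using assms mult_mono[of 1 x 1 y] by (auto simp: delayed_pos_def split: if_splits)

text \<open>
  Every positive real is positive at the upper world, which lies above both worlds; so a
  negated positivity statement means the same at either of them.
\<close>

lemma forces_not_pos: "forces delayed_pos w e (\<^bold>\<not> Pos t) \<longleftrightarrow> eval e t \<le> 0"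
proof -
  have "forces delayed_pos w e (\<^bold>\<not> Pos t) \<longleftrightarrow> (\<forall>v\<ge>w. \<not> delayed_pos v (eval e t))"
    by (simp only: forces.simps simp_thms)
  also have "\<dots> \<longleftrightarrow> eval e t \<le> 0"
    by (simp only: all_later_bool) (auto simp: delayed_pos_def)
  finally show ?thesis .
qed

lemma forces_axioms:
  assumes "A \<in> euclidean_field_axioms - {EF6}"
  shows "forces delayed_pos w e A"
proof -
  have ring: "forces delayed_pos w e A" if "A \<in> comm_ring_axioms"
    using that by (auto simp: comm_ring_axioms_def algebra_simps numeral_2_eq_2)
  have stab: "forces delayed_pos w e eq_stability"
    by (auto simp: eq_stability_def)
  have ef0: "forces delayed_pos w e EF0"
    by (simp add: EF0_def)
  have ef1: "forces delayed_pos w e EF1"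
    unfolding EF1_def
  proof (intro forces_AllI forces_ImpI)
    fix x v
    let ?e = "case_nat x e"
    assume "forces delayed_pos v ?e (Var 0 \<^bold>\<noteq> \<^bold>0)"
    then have "x * inverse x = 1" by auto
    then show "forces delayed_pos v ?e (\<^bold>\<exists> (Var 1 \<^bold>* Var 0 \<^bold>= \<^bold>1))"
      by (auto simp del: right_inverse)
  qed
  have ef2: "forces delayed_pos w e EF2"
    by (auto simp: EF2_def delayed_pos_add_mult)
  have ef3: "forces delayed_pos w e EF3"
    by (auto simp: EF3_def delayed_pos_def split: if_splits)
  have ef4: "forces delayed_pos w e EF4"
    unfolding EF4_def
    by (intro forces_AllI forces_ImpI)
      (simp del: forces.simps(6) add: forces_not_pos)
  have ef5: "forces delayed_pos w e EF5"
    unfolding EF5_def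
  proof (intro forces_AllI forces_ImpI)
    fix x y v
    let ?e = "case_nat y (case_nat x e)"
    assume "forces delayed_pos v ?e (Var 1 \<^bold>+ Var 0 \<^bold>= \<^bold>0 \<^bold>\<and> \<^bold>\<not> Pos (Var 0))"
    then have "0 \<le> x" by (simp del: forces.simps(6) add: forces_not_pos)
    then have "\<exists>z. z * z = x" by (intro exI[of _ "sqrt x"]) simp
    then show "forces delayed_pos v ?e (\<^bold>\<exists> (Var 0 \<^bold>* Var 0 \<^bold>= Var 2))"
      by (simp add: numeral_2_eq_2)
  qed
  show ?thesis
    using assms ring stab ef0 ef1 ef2 ef3 ef4 ef5 by (auto simp: euclidean_field_axioms_def)
qed

lemma not_forces_markov: "\<not> forces delayed_pos False e EF6"
proof
  assume "forces delayed_pos False e EF6"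
  then have "forces delayed_pos False (case_nat (1/2) e) (\<^bold>\<not>\<^bold>\<not> Pos (Var 0) \<^bold>\<longrightarrow> Pos (Var 0))"
    unfolding EF6_def forces.simps by blast
  moreover have "forces delayed_pos False (case_nat (1/2) e) (\<^bold>\<not>\<^bold>\<not> Pos (Var 0))"
    by (subst forces.simps(6)) (simp add: forces_not_pos del: forces.simps(6))
  ultimately have "forces delayed_pos False (case_nat (1/2) e) (Pos (Var 0))"
    by (subst (asm) forces.simps(6)) blast
  then show False
    by (simp add: delayed_pos_def)
qed

theorem theorem10p5: "\<not> (euclidean_field_axioms - {EF6} \<turnstile> EF6)"
proof
  assume "euclidean_field_axioms - {EF6} \<turnstile> EF6"
  then have "forces delayed_pos False (\<lambda>_. 0) EF6"
    using mono_delayed_pos forces_axioms by (rule soundness)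
  then show False
    using not_forces_markov by contradiction
qed

end
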